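(* Let $T=(V,E)$ be a finite tree with at least one edge, let $\widetilde w:[0,\infty)\to(0,\infty)^E$ be a solution of the unnormalized flow $\dot{\widetilde w}_e=-\kappa_e(\widetilde w)\widetilde w_e$ with positive initial metric, and let $w=\widetilde w/\sum_{f\in E}\widetilde w_f$ be its normalization. Write $\kappa_e(t)=\kappa_e(\widetilde w(t))=\kappa_e(w(t))$. Then for every $e\in E$ the limit $$c_e:=\lim_{t\to\infty}\kappa_e(t)$$ exists. Put $c_*:=\min_{e\in E}c_e$ and $E_*:=\{e\in E:c_e=c_*\}$. Then for every $e\in E$ $$\lim_{t\to\infty}\frac1t\log\widetilde w_e(t)=-c_e,\qquad \lim_{t\to\infty}\frac1t\log w_e(t)=c_*-c_e .$$ Therefore every edge outside $E_*$ has exponentially vanishing normalized weight.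
   Context: $T=(V,E)$ is a finite tree with at least one edge; $d_x$ is the combinatorial degree of $x\in V$. A positive metric is $w=(w_e)_{e\in E}$ with all $w_e>0$; it induces the path metric $d_w$ on $V$. Put $D_x(w)=\sum_{e\ni x}1/w_e$. For $\alpha\in[0,1)$ let $m_x^\alpha(x)=\alpha$ and $m_x^\alpha(z)=(1-\alpha)\,w_{xz}^{-1}/D_x(w)$ for $z\sim x$. The (inverse-weight) Lin--Lu--Yau curvature of $e=xy$ is $\kappa_e(w)=\lim_{\alpha\uparrow1}\frac{1-W_1(m_x^\alpha,m_y^\alpha)/w_e}{1-\alpha}$, with $W_1$ the $1$-Wasserstein distance for $d_w$. Known formula on trees: $\kappa_{xy}(w)=\frac{2-d_x}{w_{xy}D_x(w)}+\frac{2-d_y}{w_{xy}D_y(w)}$. Curvature is invariant under common rescaling $w\mapsto sw$, $s>0$. The normalization $w$ solves the normalized flow $\dot w_e=-w_e(\kappa_e(w)-K(w))$, $K(w)=\sum_f w_f\kappa_f(w)$. *)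

theory Defs
  imports "HOL-Analysis.Analysis"
begin

section \<open>Finite trees\<close>

text \<open>
  A simple graph is a vertex set \<open>V\<close> with a set \<open>E\<close> of two-element subsets of \<open>V\<close>.
  A walk is the nonempty list of the vertices it visits; a one-element list is the trivial walk.
\<close>

definition simple_graph :: "'a set \<Rightarrow> 'a set set \<Rightarrow> bool" where
  "simple_graph V E \<longleftrightarrow> (\<forall>e\<in>E. e \<subseteq> V \<and> card e = 2)"

definition graph_walk :: "'a set \<Rightarrow> 'a set set \<Rightarrow> 'a list \<Rightarrow> bool" where
  "graph_walk V E p \<longleftrightarrow> p \<noteq> [] \<and> set p \<subseteq> V \<and> successively (\<lambda>x y. {x, y} \<in> E) p"

definition graph_walks_between :: "'a set \<Rightarrow> 'a set set \<Rightarrow> 'a \<Rightarrow> 'a \<Rightarrow> 'a list set" where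
  "graph_walks_between V E x y = {p. graph_walk V E p \<and> hd p = x \<and> last p = y}"

definition graph_connected :: "'a set \<Rightarrow> 'a set set \<Rightarrow> bool" where
  "graph_connected V E \<longleftrightarrow> V \<noteq> {} \<and> (\<forall>x\<in>V. \<forall>y\<in>V. graph_walks_between V E x y \<noteq> {})"

definition graph_cycle :: "'a set \<Rightarrow> 'a set set \<Rightarrow> 'a list \<Rightarrow> bool" where
  "graph_cycle V E p \<longleftrightarrow>
     graph_walk V E p \<and> distinct p \<and> length p \<ge> 3 \<and> {last p, hd p} \<in> E"

definition finite_tree :: "'a set \<Rightarrow> 'a set set \<Rightarrow> bool" where
  "finite_tree V E \<longleftrightarrow>
     finite V \<and> simple_graph V E \<and> graph_connected V E \<and> (\<nexists>p. graph_cycle V E p)"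


section \<open>Weights, path metric and Wasserstein distance\<close>

text \<open>
  Edge weights are functions on all sets of vertices; only the values on \<open>E\<close> matter.
\<close>

definition positive_metric :: "'a set set \<Rightarrow> ('a set \<Rightarrow> real) \<Rightarrow> bool" where
  "positive_metric E w \<longleftrightarrow> (\<forall>e\<in>E. w e > 0)"

definition walk_weight :: "('a set \<Rightarrow> real) \<Rightarrow> 'a list \<Rightarrow> real" where
  "walk_weight w p = (\<Sum>(x, y)\<leftarrow>zip p (tl p). w {x, y})"

definition path_metric :: "'a set \<Rightarrow> 'a set set \<Rightarrow> ('a set \<Rightarrow> real) \<Rightarrow> 'a \<Rightarrow> 'a \<Rightarrow> real" where
  "path_metric V E w x y = Inf (walk_weight w ` graph_walks_between V E x y)"

text \<open>
  Probability measures on the finite set \<open>V\<close> are given by their mass functions.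
\<close>

definition couplings :: "'a set \<Rightarrow> ('a \<Rightarrow> real) \<Rightarrow> ('a \<Rightarrow> real) \<Rightarrow> ('a \<Rightarrow> 'a \<Rightarrow> real) set" where
  "couplings V \<mu> \<nu> = {\<pi>. (\<forall>u\<in>V. \<forall>v\<in>V. \<pi> u v \<ge> 0) \<and>
     (\<forall>u\<in>V. (\<Sum>v\<in>V. \<pi> u v) = \<mu> u) \<and> (\<forall>v\<in>V. (\<Sum>u\<in>V. \<pi> u v) = \<nu> v)}"

definition wasserstein1 ::
  "'a set \<Rightarrow> ('a \<Rightarrow> 'a \<Rightarrow> real) \<Rightarrow> ('a \<Rightarrow> real) \<Rightarrow> ('a \<Rightarrow> real) \<Rightarrow> real" where
  "wasserstein1 V d \<mu> \<nu> = Inf ((\<lambda>\<pi>. \<Sum>u\<in>V. \<Sum>v\<in>V. d u v * \<pi> u v) ` couplings V \<mu> \<nu>)"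


section \<open>Inverse-weight Lin--Lu--Yau curvature and flow\<close>

definition inv_weight_degree :: "'a set set \<Rightarrow> ('a set \<Rightarrow> real) \<Rightarrow> 'a \<Rightarrow> real" where
  "inv_weight_degree E w x = (\<Sum>e\<in>{e\<in>E. x \<in> e}. 1 / w e)"

definition lazy_measure :: "'a set set \<Rightarrow> ('a set \<Rightarrow> real) \<Rightarrow> real \<Rightarrow> 'a \<Rightarrow> 'a \<Rightarrow> real" where
  "lazy_measure E w \<alpha> x z =
     (if z = x then \<alpha>
      else if {x, z} \<in> E then (1 - \<alpha>) * inverse (w {x, z}) / inv_weight_degree E w x
      else 0)"

text \<open>
  An edge is an unordered pair, so the curvature of \<open>e\<close> is the common limit over the two
  labellings \<open>e = {x, y}\<close>; they agree because \<open>wasserstein1\<close> with \<open>path_metric\<close> is symmetric.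
\<close>

definition lly_curvature :: "'a set \<Rightarrow> 'a set set \<Rightarrow> ('a set \<Rightarrow> real) \<Rightarrow> 'a set \<Rightarrow> real" where
  "lly_curvature V E w e = (THE k. \<forall>x y. e = {x, y} \<longrightarrow>
     ((\<lambda>\<alpha>. (1 - wasserstein1 V (path_metric V E w)
                 (lazy_measure E w \<alpha> x) (lazy_measure E w \<alpha> y) / w e) / (1 - \<alpha>))
       \<longlongrightarrow> k) (at_left 1))"

definition unnormalized_flow_solution ::
  "'a set \<Rightarrow> 'a set set \<Rightarrow> (real \<Rightarrow> 'a set \<Rightarrow> real) \<Rightarrow> bool" where
  "unnormalized_flow_solution V E W \<longleftrightarrow>
     (\<forall>t\<ge>0. positive_metric E (W t)) \<and>
     (\<forall>t\<ge>0. \<forall>e\<in>E. ((\<lambda>s. W s e) has_real_derivative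
        - lly_curvature V E (W t) e * W t e) (at t within {0..}))"

definition normalized_metric :: "'a set set \<Rightarrow> ('a set \<Rightarrow> real) \<Rightarrow> 'a set \<Rightarrow> real" where
  "normalized_metric E w e = w e / (\<Sum>f\<in>E. w f)"

end

theory Submission
  imports Defs
begin

text \<open>
  On a tree the optimal transport between the two lazy measures at the ends of an edge is certified
  by an explicit potential together with an explicit coupling; this gives the closed formula for the
  curvature. In the coordinates \<open>u = ln W\<close> the formula says that the curvature is the gradient of
  \<open>\<Phi> = (\<Sum>x. (d\<^sub>x - 2) * ln D\<^sub>x)\<close>, so the unnormalized flow is \<open>u' = - \<nabla>\<Phi>(u)\<close>, and \<open>\<Phi>\<close> is convex.

  For a gradient flow of a convex function, the speed \<open>|\<nabla>\<Phi>|\<close> decreases to some \<open>l\<close>. With the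
  mean velocity \<open>q = (u(s) - u(t)) / (t - s)\<close>, convexity and energy dissipation give
  \<open>\<langle>\<nabla>\<Phi>(u(s)), q\<rangle> \<ge> l\<^sup>2\<close>, while \<open>|q| \<le> |\<nabla>\<Phi>(u(s))|\<close>. Hence
  \<open>|\<nabla>\<Phi>(u(s)) - q|\<^sup>2 \<le> 2 (|\<nabla>\<Phi>(u(s))|\<^sup>2 - l\<^sup>2)\<close> for all \<open>t > s\<close>. As \<open>t\<close> tends to infinity
  \<open>q\<close> becomes independent of \<open>s\<close>, so the gradient converges, and \<open>- u(t) / t\<close> has the same limit.
\<close>

section \<open>Potentials and couplings on trees\<close>

definition incident_edges :: "'a set set \<Rightarrow> 'a \<Rightarrow> 'a set set" where
  "incident_edges E x = {e \<in> E. x \<in> e}"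

definition neighbours :: "'a set set \<Rightarrow> 'a \<Rightarrow> 'a set" where
  "neighbours E x = {z. {x, z} \<in> E}"

lemma graph_walk_Cons_Cons:
  "graph_walk V E (u # v # p) \<longleftrightarrow> u \<in> V \<and> {u, v} \<in> E \<and> graph_walk V E (v # p)"
  by (auto simp: graph_walk_def)

lemma walk_weight_Cons_Cons: "walk_weight w (u # v # p) = w {u, v} + walk_weight w (v # p)"
  by (simp add: walk_weight_def)

lemma walk_weight_nonneg:
  "positive_metric E w \<Longrightarrow> graph_walk V E p \<Longrightarrow> walk_weight w p \<ge> 0"
proof (induction p rule: induct_list012)
  case (3 u v p)
  then show ?case
    by (auto simp: graph_walk_Cons_Cons walk_weight_Cons_Cons positive_metric_def
        intro!: add_nonneg_nonneg less_imp_le)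
qed (auto simp: walk_weight_def)

lemma graph_walk_cut_loop:
  assumes "graph_walk V E (xs @ y # ys @ y # zs)"
  shows "graph_walk V E (xs @ y # zs)"
  using assms by (auto simp: graph_walk_def successively_append_iff successively_Cons)

lemma distinct_walk_exists:
  assumes "graph_walk V E p"
  shows "\<exists>q. graph_walk V E q \<and> hd q = hd p \<and> last q = last p \<and> distinct q"
  using assms
proof (induction "length p" arbitrary: p rule: less_induct)
  case less
  show ?case
  proof (cases "distinct p")
    case False
    then obtain xs y ys zs where p: "p = xs @ y # ys @ y # zs"
      using not_distinct_decomp[of p] by auto
    have "length (xs @ y # zs) < length p" by (simp add: p)
    moreover have "graph_walk V E (xs @ y # zs)"
      by (rule graph_walk_cut_loop[of _ _ _ _ ys]) (use less.prems in \<open>simp add: p\<close>)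
    moreover have "hd (xs @ y # zs) = hd p" "last (xs @ y # zs) = last p"
      by (auto simp: p hd_append)
    ultimately show ?thesis using less.hyps by metis
  qed (use less.prems in blast)
qed

lemma edge_facts:
  assumes "simple_graph V E" "{x, y} \<in> E"
  shows "x \<in> V" "y \<in> V" "x \<noteq> y"
  using assms by (auto simp: simple_graph_def card_insert_if split: if_splits)

lemma tree_edge_is_bridge:
  assumes tree: "finite_tree V E" and e: "{x, y} \<in> E"
    and p: "graph_walk V (E - {{x, y}}) p" "hd p = x"
  shows "last p \<noteq> y"
proof
  assume "last p = y"
  then obtain q where q: "graph_walk V (E - {{x, y}}) q" "hd q = x" "last q = y" "distinct q"
    using distinct_walk_exists[OF p(1)] p(2) by blast
  have xy: "x \<noteq> y" using tree e edge_facts unfolding finite_tree_def by metis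
  have "length q \<ge> 3"
  proof (rule ccontr)
    assume "\<not> length q \<ge> 3"
    then consider "q = []" | u where "q = [u]" | u v where "q = [u, v]"
      by (cases q rule: remdups_adj.cases) (auto simp: Suc_le_eq)
    then show False using q xy by cases (auto simp: graph_walk_def)
  qed
  moreover have "graph_walk V E q"
    using q(1) by (auto simp: graph_walk_def elim: successively_mono)
  ultimately have "graph_cycle V E q"
    using q e by (simp add: graph_cycle_def insert_commute)
  then show False using tree by (auto simp: finite_tree_def)
qed

definition tree_side :: "'a set \<Rightarrow> 'a set set \<Rightarrow> 'a \<Rightarrow> 'a \<Rightarrow> 'a set" where
  "tree_side V E x y = {u. graph_walks_between V (E - {{x, y}}) x u \<noteq> {}}"

lemma tree_side_ends:
  assumes "finite_tree V E" "{x, y} \<in> E"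
  shows "x \<in> tree_side V E x y" "y \<notin> tree_side V E x y"
proof -
  have "x \<in> V" using assms edge_facts unfolding finite_tree_def by metis
  then have "[x] \<in> graph_walks_between V (E - {{x, y}}) x x"
    by (auto simp: graph_walks_between_def graph_walk_def)
  then show "x \<in> tree_side V E x y" by (auto simp: tree_side_def)
  show "y \<notin> tree_side V E x y"
    using tree_edge_is_bridge[OF assms] by (auto simp: tree_side_def graph_walks_between_def)
qed

lemma tree_side_step:
  assumes sg: "simple_graph V E" and uv: "{u, v} \<in> E" "{u, v} \<noteq> {x, y}"
    and u: "u \<in> tree_side V E x y"
  shows "v \<in> tree_side V E x y"
proof -
  obtain p where p: "graph_walk V (E - {{x, y}}) p" "hd p = x" "last p = u"
    using u by (auto simp: tree_side_def graph_walks_between_def)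
  have "p @ [v] \<in> graph_walks_between V (E - {{x, y}}) x v"
    using p uv edge_facts[OF sg uv(1)]
    by (auto simp: graph_walks_between_def graph_walk_def successively_append_iff)
  then show ?thesis by (auto simp: tree_side_def)
qed

lemma tree_side_cong:
  assumes "simple_graph V E" "{u, v} \<in> E" "{u, v} \<noteq> {x, y}"
  shows "u \<in> tree_side V E x y \<longleftrightarrow> v \<in> tree_side V E x y"
  using tree_side_step[OF assms] tree_side_step[OF assms(1), of v u] assms
  by (metis insert_commute)

lemma path_metric_le:
  assumes "positive_metric E w" "p \<in> graph_walks_between V E x y"
  shows "path_metric V E w x y \<le> walk_weight w p"
  unfolding path_metric_def using assms walk_weight_nonneg[OF assms(1)]
  by (intro cInf_lower bdd_belowI2[of _ 0]) (auto simp: graph_walks_between_def)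

definition edge_lipschitz :: "'a set set \<Rightarrow> ('a set \<Rightarrow> real) \<Rightarrow> ('a \<Rightarrow> real) \<Rightarrow> bool" where
  "edge_lipschitz E w f \<longleftrightarrow> (\<forall>u v. {u, v} \<in> E \<longrightarrow> f u - f v \<le> w {u, v})"

lemma edge_lipschitz_walk:
  "edge_lipschitz E w f \<Longrightarrow> graph_walk V E p \<Longrightarrow> f (hd p) - f (last p) \<le> walk_weight w p"
proof (induction p rule: induct_list012)
  case (3 u v p)
  then have "f u - f v \<le> w {u, v}" "f v - f (last (v # p)) \<le> walk_weight w (v # p)"
    by (auto simp: graph_walk_Cons_Cons edge_lipschitz_def)
  then show ?case by (simp add: walk_weight_Cons_Cons)
qed (auto simp: graph_walk_def walk_weight_def)

lemma edge_lipschitz_le_path_metric: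
  assumes "graph_connected V E" "edge_lipschitz E w f" "x \<in> V" "y \<in> V"
  shows "f x - f y \<le> path_metric V E w x y"
  unfolding path_metric_def using assms edge_lipschitz_walk[OF assms(2)]
  by (intro cInf_greatest) (auto simp: graph_connected_def graph_walks_between_def)

lemma path_metric_self:
  assumes "positive_metric E w" "x \<in> V"
  shows "path_metric V E w x x = 0"
proof (rule antisym)
  have walk: "[x] \<in> graph_walks_between V E x x"
    using assms by (auto simp: graph_walks_between_def graph_walk_def)
  then show "path_metric V E w x x \<le> 0"
    using path_metric_le[OF assms(1) walk] by (simp add: walk_weight_def)
  show "0 \<le> path_metric V E w x x"
    unfolding path_metric_def
  proof (rule cInf_greatest)
    show "walk_weight w ` graph_walks_between V E x x \<noteq> {}" using walk by blast
  qed (auto simp: graph_walks_between_def walk_weight_nonneg[OF assms(1)])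
qed

lemma walk_weight_snoc:
  "p \<noteq> [] \<Longrightarrow> walk_weight w (p @ [v]) = walk_weight w p + w {last p, v}"
proof (induction p rule: induct_list012)
  case (3 a b p)
  then show ?case using walk_weight_Cons_Cons[of w a b "p @ [v]"]
    by (simp add: walk_weight_Cons_Cons)
qed (auto simp: walk_weight_def)

lemma path_metric_step:
  assumes "graph_connected V E" "simple_graph V E" "positive_metric E w" "a \<in> V" "{u, v} \<in> E"
  shows "path_metric V E w a v \<le> path_metric V E w a u + w {u, v}"
proof -
  note uv = edge_facts[OF assms(2,5)]
  have "path_metric V E w a v - w {u, v} \<le> path_metric V E w a u"
    unfolding path_metric_def[of V E w a u]
  proof (rule cInf_greatest)
    show "walk_weight w ` graph_walks_between V E a u \<noteq> {}"
      using assms uv by (auto simp: graph_connected_def)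
    fix r assume "r \<in> walk_weight w ` graph_walks_between V E a u"
    then obtain p where p: "p \<in> graph_walks_between V E a u" "r = walk_weight w p" by blast
    then have "p @ [v] \<in> graph_walks_between V E a v"
      using uv assms(5)
      by (auto simp: graph_walks_between_def graph_walk_def successively_append_iff)
    then have "path_metric V E w a v \<le> walk_weight w (p @ [v])"
      using path_metric_le[OF assms(3)] by blast
    also have "\<dots> = r + w {u, v}"
      using p by (auto simp: walk_weight_snoc graph_walks_between_def graph_walk_def)
    finally show "path_metric V E w a v - w {u, v} \<le> r" by simp
  qed
  then show ?thesis by simp
qed

lemma tree_path_metric_edge:
  assumes tree: "finite_tree V E" and pos: "positive_metric E w" and e: "{x, y} \<in> E"
  shows "path_metric V E w x y = w {x, y}"
proof (rule antisym)
  have sg: "simple_graph V E" and conn: "graph_connected V E"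
    using tree by (auto simp: finite_tree_def)
  note xy = edge_facts[OF sg e]
  have "[x, y] \<in> graph_walks_between V E x y"
    using e xy by (auto simp: graph_walks_between_def graph_walk_def)
  from path_metric_le[OF pos this] show "path_metric V E w x y \<le> w {x, y}"
    by (simp add: walk_weight_def)
  define f where "f u = (if u \<in> tree_side V E x y then w {x, y} else 0)" for u
  have "edge_lipschitz E w f"
    unfolding edge_lipschitz_def
  proof (intro allI impI)
    fix u v assume uv: "{u, v} \<in> E"
    show "f u - f v \<le> w {u, v}"
    proof (cases "{u, v} = {x, y}")
      case True
      then show ?thesis using pos e unfolding positive_metric_def f_def True by force
    next
      case False
      then have "u \<in> tree_side V E x y \<longleftrightarrow> v \<in> tree_side V E x y"
        using tree_side_cong[OF sg uv] by blast
      then show ?thesis using pos uv by (auto simp: f_def positive_metric_def less_imp_le)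
    qed
  qed
  from edge_lipschitz_le_path_metric[OF conn this xy(1,2)] show "w {x, y} \<le> path_metric V E w x y"
    using tree_side_ends[OF tree e] by (simp add: f_def)
qed

text \<open>
  The Kantorovich potential transporting mass across the edge \<open>xy\<close>: signed distance to \<open>y\<close>.
\<close>

lemma tree_edge_potential:
  assumes tree: "finite_tree V E" and pos: "positive_metric E w" and e: "{x, y} \<in> E"
  obtains f where "edge_lipschitz E w f" "f x = w {x, y}" "f y = 0"
    "\<And>z. {x, z} \<in> E \<Longrightarrow> z \<noteq> y \<Longrightarrow> f z = w {x, y} + w {x, z}"
    "\<And>z. {y, z} \<in> E \<Longrightarrow> z \<noteq> x \<Longrightarrow> f z = - w {y, z}"
proof -
  define d where "d = path_metric V E w"
  define S where "S = tree_side V E x y"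
  define f where "f u = (if u \<in> S then w {x, y} + d x u else - d y u)" for u
  have sg: "simple_graph V E" and conn: "graph_connected V E"
    using tree by (auto simp: finite_tree_def)
  note xy = edge_facts[OF sg e]
  have S: "x \<in> S" "y \<notin> S" unfolding S_def using tree_side_ends[OF tree e] .
  have d_self: "d x x = 0" "d y y = 0" unfolding d_def using path_metric_self[OF pos] xy by auto
  have step: "d a v \<le> d a u + w {u, v}" if "a \<in> V" "{u, v} \<in> E" for a u v
    unfolding d_def using path_metric_step[OF conn sg pos that] .
  have S_cong: "u \<in> S \<longleftrightarrow> v \<in> S" if uv: "{u, v} \<in> E" "{u, v} \<noteq> {x, y}" for u v
    unfolding S_def using tree_side_cong[OF sg uv] .
  have "edge_lipschitz E w f"
    unfolding edge_lipschitz_def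
  proof (intro allI impI)
    fix u v assume uv: "{u, v} \<in> E"
    show "f u - f v \<le> w {u, v}"
    proof (cases "{u, v} = {x, y}")
      case True
      then have "u = x \<and> v = y \<or> u = y \<and> v = x" by (auto simp: doubleton_eq_iff)
      moreover have "w {x, y} > 0" using pos e by (simp add: positive_metric_def)
      ultimately show ?thesis using S d_self by (auto simp: f_def insert_commute)
    next
      case False
      have "d x u \<le> d x v + w {u, v}" "d y v \<le> d y u + w {u, v}"
        using step[of x v u] step[of y u v] uv xy by (auto simp: insert_commute)
      then show ?thesis using S_cong[OF uv False] by (auto simp: f_def)
    qed
  qed
  moreover have "f x = w {x, y}" "f y = 0" using S d_self by (auto simp: f_def)
  moreover have "f z = w {x, y} + w {x, z}" if z: "{x, z} \<in> E" "z \<noteq> y" for z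
    using tree_path_metric_edge[OF tree pos z(1)] S_cong[OF z(1)] z(2) S
    by (auto simp: f_def d_def doubleton_eq_iff)
  moreover have "f z = - w {y, z}" if z: "{y, z} \<in> E" "z \<noteq> x" for z
    using tree_path_metric_edge[OF tree pos z(1)] S_cong[OF z(1)] z(2) S
    by (auto simp: f_def d_def doubleton_eq_iff)
  ultimately show ?thesis using that by blast
qed

lemma wasserstein1_eqI:
  assumes lip: "\<And>u v. u \<in> V \<Longrightarrow> v \<in> V \<Longrightarrow> f u - f v \<le> d u v"
    and \<pi>: "\<pi> \<in> couplings V \<mu> \<nu>"
    and tight: "\<And>u v. u \<in> V \<Longrightarrow> v \<in> V \<Longrightarrow> \<pi> u v \<noteq> 0 \<Longrightarrow> d u v \<le> f u - f v"
  shows "wasserstein1 V d \<mu> \<nu> = (\<Sum>u\<in>V. f u * \<mu> u) - (\<Sum>u\<in>V. f u * \<nu> u)"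
proof -
  define D where "D = (\<Sum>u\<in>V. f u * \<mu> u) - (\<Sum>u\<in>V. f u * \<nu> u)"
  have dual: "(\<Sum>u\<in>V. \<Sum>v\<in>V. (f u - f v) * \<rho> u v) = D" if "\<rho> \<in> couplings V \<mu> \<nu>" for \<rho>
  proof -
    have "(\<Sum>u\<in>V. \<Sum>v\<in>V. (f u - f v) * \<rho> u v)
        = (\<Sum>u\<in>V. f u * (\<Sum>v\<in>V. \<rho> u v)) - (\<Sum>u\<in>V. \<Sum>v\<in>V. f v * \<rho> u v)"
      by (simp add: left_diff_distrib sum_subtractf sum_distrib_left)
    also have "(\<Sum>u\<in>V. \<Sum>v\<in>V. f v * \<rho> u v) = (\<Sum>v\<in>V. f v * (\<Sum>u\<in>V. \<rho> u v))"
      by (subst sum.swap) (simp add: sum_distrib_left)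
    finally show ?thesis using that by (simp add: couplings_def D_def)
  qed
  have ge: "D \<le> (\<Sum>u\<in>V. \<Sum>v\<in>V. d u v * \<rho> u v)" if \<rho>: "\<rho> \<in> couplings V \<mu> \<nu>" for \<rho>
    unfolding dual[OF \<rho>, symmetric] using \<rho> lip
    by (intro sum_mono mult_right_mono) (auto simp: couplings_def)
  have "(\<Sum>u\<in>V. \<Sum>v\<in>V. d u v * \<pi> u v) = (\<Sum>u\<in>V. \<Sum>v\<in>V. (f u - f v) * \<pi> u v)"
    using lip tight by (intro sum.cong refl) (metis antisym mult_eq_0_iff)
  then have attained: "(\<Sum>u\<in>V. \<Sum>v\<in>V. d u v * \<pi> u v) = D" using dual[OF \<pi>] by simp
  show ?thesis
    unfolding wasserstein1_def D_def[symmetric]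
    by (rule cInf_eq_minimum) (use \<pi> attained ge in auto)
qed

lemma common_part_coupling:
  fixes \<mu> \<nu> \<eta> :: "'a \<Rightarrow> real"
  assumes fin: "finite V"
    and \<eta>: "\<And>u. u \<in> V \<Longrightarrow> 0 \<le> \<eta> u" "\<And>u. u \<in> V \<Longrightarrow> \<eta> u \<le> \<mu> u" "\<And>u. u \<in> V \<Longrightarrow> \<eta> u \<le> \<nu> u"
    and mass: "(\<Sum>u\<in>V. \<mu> u - \<eta> u) = M" "(\<Sum>u\<in>V. \<nu> u - \<eta> u) = M" "M > 0"
  shows "(\<lambda>u v. (if u = v then \<eta> u else 0) + (\<mu> u - \<eta> u) * (\<nu> v - \<eta> v) / M) \<in> couplings V \<mu> \<nu>"
proof -
  have "(\<Sum>v\<in>V. (if u = v then \<eta> u else 0) + (\<mu> u - \<eta> u) * (\<nu> v - \<eta> v) / M) = \<mu> u"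
    if "u \<in> V" for u
  proof -
    have "(\<Sum>v\<in>V. (\<mu> u - \<eta> u) * (\<nu> v - \<eta> v) / M) = (\<mu> u - \<eta> u) * (\<Sum>v\<in>V. \<nu> v - \<eta> v) / M"
      by (simp only: sum_distrib_left sum_divide_distrib)
    then show ?thesis using fin that mass by (simp add: sum.distrib)
  qed
  moreover have "(\<Sum>u\<in>V. (if u = v then \<eta> u else 0) + (\<mu> u - \<eta> u) * (\<nu> v - \<eta> v) / M) = \<nu> v"
    if "v \<in> V" for v
  proof -
    have "(\<Sum>u\<in>V. (\<mu> u - \<eta> u) * (\<nu> v - \<eta> v) / M) = (\<Sum>u\<in>V. \<mu> u - \<eta> u) * (\<nu> v - \<eta> v) / M"
      by (simp only: sum_distrib_right sum_divide_distrib)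
    then show ?thesis using fin that mass by (simp add: sum.distrib)
  qed
  moreover have "(if u = v then \<eta> u else 0) + (\<mu> u - \<eta> u) * (\<nu> v - \<eta> v) / M \<ge> 0"
    if "u \<in> V" "v \<in> V" for u v
    using \<eta> that mass(3) by (intro add_nonneg_nonneg divide_nonneg_pos mult_nonneg_nonneg) auto
  ultimately show ?thesis by (simp add: couplings_def)
qed

section \<open>The curvature of a tree\<close>

lemma neighbours_bij_incident_edges:
  assumes "simple_graph V E"
  shows "bij_betw (\<lambda>z. {x, z}) (neighbours E x) (incident_edges E x)"
proof (rule bij_betwI')
  fix e assume e: "e \<in> incident_edges E x"
  then have "card e = 2" "x \<in> e" using assms by (auto simp: incident_edges_def simple_graph_def)
  then obtain z where "e = {x, z}" by (auto simp: card_2_iff)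
  then show "\<exists>z\<in>neighbours E x. e = {x, z}"
    using e by (auto simp: incident_edges_def neighbours_def)
qed (auto simp: incident_edges_def neighbours_def doubleton_eq_iff)

lemma neighbours_subset: "simple_graph V E \<Longrightarrow> neighbours E x \<subseteq> V - {x}"
  by (auto simp: neighbours_def dest: edge_facts)

lemma inv_weight_degree_neighbours:
  assumes "simple_graph V E"
  shows "inv_weight_degree E w x = (\<Sum>z\<in>neighbours E x. 1 / w {x, z})"
  using sum.reindex_bij_betw[OF neighbours_bij_incident_edges[OF assms], of "\<lambda>e. 1 / w e" x]
  by (simp add: inv_weight_degree_def incident_edges_def)

lemma inv_weight_degree_pos:
  assumes "finite E" "positive_metric E w" "incident_edges E x \<noteq> {}"
  shows "inv_weight_degree E w x > 0"
  unfolding inv_weight_degree_def using assms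
  by (intro sum_pos) (auto simp: positive_metric_def incident_edges_def)

lemma finite_tree_edges: "finite_tree V E \<Longrightarrow> finite E"
  by (rule finite_subset[of _ "Pow V"]) (auto simp: finite_tree_def simple_graph_def)

lemma sum_lazy_measure:
  assumes sg: "simple_graph V E" and fin: "finite V" and x: "x \<in> V"
  shows "(\<Sum>z\<in>V. h z * lazy_measure E w \<alpha> x z)
    = \<alpha> * h x + (1 - \<alpha>) / inv_weight_degree E w x * (\<Sum>z\<in>neighbours E x. h z / w {x, z})"
proof -
  have "(\<Sum>z\<in>V. h z * lazy_measure E w \<alpha> x z)
      = h x * \<alpha> + (\<Sum>z\<in>V - {x}. h z * lazy_measure E w \<alpha> x z)"
    using fin x by (subst sum.remove[of _ x]) (auto simp: lazy_measure_def)
  also have "(\<Sum>z\<in>V - {x}. h z * lazy_measure E w \<alpha> x z)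
      = (\<Sum>z\<in>neighbours E x. (1 - \<alpha>) / inv_weight_degree E w x * (h z / w {x, z}))"
    using fin neighbours_subset[OF sg, of x]
    by (intro sum.mono_neutral_cong_right) (auto simp: lazy_measure_def neighbours_def divide_simps)
  finally show ?thesis by (simp add: sum_distrib_left mult.commute)
qed

lemma tree_wasserstein1:
  assumes tree: "finite_tree V E" and pos: "positive_metric E w" and e: "{x, y} \<in> E"
    and \<alpha>: "1 / 2 < \<alpha>" "\<alpha> < 1"
  shows "wasserstein1 V (path_metric V E w) (lazy_measure E w \<alpha> x) (lazy_measure E w \<alpha> y)
    = w {x, y} + (1 - \<alpha>) * ((real (card (incident_edges E x)) - 2) / inv_weight_degree E w x
                             + (real (card (incident_edges E y)) - 2) / inv_weight_degree E w y)"
proof -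
  have sg: "simple_graph V E" and conn: "graph_connected V E" and fin: "finite V"
    using tree by (auto simp: finite_tree_def)
  note xy = edge_facts[OF sg e]
  have e': "{y, x} \<in> E" using e by (simp add: insert_commute)
  obtain f where f: "edge_lipschitz E w f" "f x = w {x, y}" "f y = 0"
    "\<And>z. {x, z} \<in> E \<Longrightarrow> z \<noteq> y \<Longrightarrow> f z = w {x, y} + w {x, z}"
    "\<And>z. {y, z} \<in> E \<Longrightarrow> z \<noteq> x \<Longrightarrow> f z = - w {y, z}"
    using tree_edge_potential[OF tree pos e] by blast
  define \<mu> where "\<mu> = lazy_measure E w \<alpha> x"
  define \<nu> where "\<nu> = lazy_measure E w \<alpha> y"
  define \<eta> where "\<eta> u = (if u = x then \<nu> x else if u = y then \<mu> y else 0)" for u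
  define M where "M = 1 - \<nu> x - \<mu> y"
  define \<pi> where "\<pi> u v = (if u = v then \<eta> u else 0) + (\<mu> u - \<eta> u) * (\<nu> v - \<eta> v) / M" for u v
  have w_pos: "w g > 0" if "g \<in> E" for g using pos that by (simp add: positive_metric_def)
  have finN: "finite (neighbours E u)" for u
    using finite_subset[OF neighbours_subset[OF sg]] fin by blast
  have deg_pos: "inv_weight_degree E w x > 0" "inv_weight_degree E w y > 0"
    using e by (auto intro!: inv_weight_degree_pos pos finite_tree_edges[OF tree] simp: incident_edges_def)
  have lazy_bounds: "0 \<le> lazy_measure E w \<alpha> a b" "lazy_measure E w \<alpha> a b \<le> 1 - \<alpha>"
    if ab: "{a, b} \<in> E" for a b
  proof -
    have "inv_weight_degree E w a > 0"
      using ab by (auto intro!: inv_weight_degree_pos pos finite_tree_edges[OF tree] simp: incident_edges_def)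
    moreover have "inverse (w {a, b}) \<le> inv_weight_degree E w a"
      unfolding inv_weight_degree_neighbours[OF sg] inverse_eq_divide
      by (rule member_le_sum[of b])
        (use ab w_pos finN in \<open>auto simp: neighbours_def less_imp_le\<close>)
    moreover have "a \<noteq> b" using edge_facts[OF sg ab] by blast
    ultimately show "0 \<le> lazy_measure E w \<alpha> a b" "lazy_measure E w \<alpha> a b \<le> 1 - \<alpha>"
      using ab \<alpha> w_pos[OF ab]
      by (auto simp: lazy_measure_def pos_divide_le_eq intro!: mult_left_mono divide_nonneg_pos)
  qed
  have \<mu>y: "0 \<le> \<mu> y" "\<mu> y \<le> 1 - \<alpha>" and \<nu>x: "0 \<le> \<nu> x" "\<nu> x \<le> 1 - \<alpha>"
    unfolding \<mu>_def \<nu>_def using lazy_bounds[OF e] lazy_bounds[OF e'] by auto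
  have \<mu>x: "\<mu> x = \<alpha>" and \<nu>y: "\<nu> y = \<alpha>" by (simp_all add: \<mu>_def \<nu>_def lazy_measure_def)
  have nonneg: "0 \<le> \<mu> u" "0 \<le> \<nu> u" for u
    using \<alpha> lazy_bounds[of x u] lazy_bounds[of y u]
    by (auto simp: \<mu>_def \<nu>_def lazy_measure_def)
  have \<eta>: "0 \<le> \<eta> u" "\<eta> u \<le> \<mu> u" "\<eta> u \<le> \<nu> u" for u
    using \<mu>y \<nu>x \<mu>x \<nu>y nonneg \<alpha> by (auto simp: \<eta>_def)
  have total: "(\<Sum>u\<in>V. \<mu> u) = 1" "(\<Sum>u\<in>V. \<nu> u) = 1"
    using sum_lazy_measure[OF sg fin xy(1), of "\<lambda>_. 1" w \<alpha>]
      sum_lazy_measure[OF sg fin xy(2), of "\<lambda>_. 1" w \<alpha>] deg_pos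
    by (simp_all add: \<mu>_def \<nu>_def flip: inv_weight_degree_neighbours[OF sg])
  have "(\<Sum>u\<in>V. \<eta> u) = (\<Sum>u\<in>{x, y}. \<eta> u)"
    using fin xy by (intro sum.mono_neutral_right) (auto simp: \<eta>_def)
  then have "(\<Sum>u\<in>V. \<eta> u) = \<nu> x + \<mu> y" using xy by (simp add: \<eta>_def)
  then have "(\<Sum>u\<in>V. \<mu> u - \<eta> u) = M" "(\<Sum>u\<in>V. \<nu> u - \<eta> u) = M"
    by (simp_all add: sum_subtractf total M_def)
  then have \<pi>: "\<pi> \<in> couplings V \<mu> \<nu>"
    unfolding \<pi>_def using fin \<eta> \<mu>y \<nu>x \<alpha>
    by (intro common_part_coupling) (auto simp: M_def)
  have walk_le: "path_metric V E w (hd p) (last p) \<le> walk_weight w p" if "graph_walk V E p" for p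
    using path_metric_le[OF pos, of p] that by (auto simp: graph_walks_between_def)
  have tight: "path_metric V E w u v \<le> f u - f v" if uv: "u \<in> V" "v \<in> V" "\<pi> u v \<noteq> 0" for u v
  proof (cases "u = v")
    case True
    then show ?thesis using path_metric_self[OF pos] uv by simp
  next
    case False
    then have "\<mu> u \<noteq> \<eta> u" "\<nu> v \<noteq> \<eta> v" using uv(3) by (auto simp: \<pi>_def)
    then have u: "u = x \<or> {x, u} \<in> E \<and> u \<noteq> y" and v: "v = y \<or> {y, v} \<in> E \<and> v \<noteq> x"
      by (auto simp: \<eta>_def \<mu>_def \<nu>_def lazy_measure_def split: if_splits)
    show ?thesis
      using u v
    proof (elim disjE)
      assume "u = x" "v = y"
      then show ?thesis
        using walk_le[of "[x, y]"] e xy f by (auto simp: graph_walk_def walk_weight_def)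
    next
      assume "u = x" "{y, v} \<in> E \<and> v \<noteq> x"
      then show ?thesis
        using walk_le[of "[x, y, v]"] e xy uv f by (auto simp: graph_walk_def walk_weight_def)
    next
      assume "{x, u} \<in> E \<and> u \<noteq> y" "v = y"
      then show ?thesis
        using walk_le[of "[u, x, y]"] e xy uv f
        by (auto simp: graph_walk_def walk_weight_def insert_commute)
    next
      assume "{x, u} \<in> E \<and> u \<noteq> y" "{y, v} \<in> E \<and> v \<noteq> x"
      then show ?thesis
        using walk_le[of "[u, x, y, v]"] e xy uv f
        by (auto simp: graph_walk_def walk_weight_def insert_commute)
    qed
  qed
  have W: "wasserstein1 V (path_metric V E w) \<mu> \<nu> = (\<Sum>u\<in>V. f u * \<mu> u) - (\<Sum>u\<in>V. f u * \<nu> u)"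
    by (rule wasserstein1_eqI[OF edge_lipschitz_le_path_metric[OF conn f(1)] \<pi> tight])
  have card_N: "card (incident_edges E u) = card (neighbours E u)" for u
    using bij_betw_same_card[OF neighbours_bij_incident_edges[OF sg]] by metis
  have card_pos: "card (neighbours E x) > 0" "card (neighbours E y) > 0"
    using finN e e' by (auto simp: card_gt_0_iff neighbours_def)
  have y_N: "y \<in> neighbours E x" and x_N: "x \<in> neighbours E y" using e e' by (auto simp: neighbours_def)
  have "(\<Sum>z\<in>neighbours E x. f z / w {x, z}) = (\<Sum>z\<in>neighbours E x - {y}. w {x, y} * (1 / w {x, z}) + 1)"
    unfolding sum.remove[OF finN y_N] using f w_pos
    by (auto intro!: sum.cong simp: neighbours_def add_divide_distrib dest!: w_pos)
  also have "\<dots> = w {x, y} * (\<Sum>z\<in>neighbours E x - {y}. 1 / w {x, z}) + (real (card (neighbours E x)) - 1)"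
    using y_N finN card_pos
    by (simp only: sum.distrib sum_distrib_left[symmetric]) (simp add: card_Diff_singleton)
  also have "(\<Sum>z\<in>neighbours E x - {y}. 1 / w {x, z}) = inv_weight_degree E w x - 1 / w {x, y}"
    unfolding inv_weight_degree_neighbours[OF sg] sum.remove[OF finN y_N] by simp
  finally have sum_x: "(\<Sum>z\<in>neighbours E x. f z / w {x, z})
      = w {x, y} * inv_weight_degree E w x + real (card (neighbours E x)) - 2"
    using w_pos[OF e] by (simp add: right_diff_distrib)
  have "f z / w {y, z} = - 1" if "z \<in> neighbours E y - {x}" for z
  proof -
    have "{y, z} \<in> E" "z \<noteq> x" using that by (auto simp: neighbours_def)
    then show ?thesis using f(5) w_pos[of "{y, z}"] by simp
  qed
  then have "(\<Sum>z\<in>neighbours E y. f z / w {y, z}) = 1 + (\<Sum>z\<in>neighbours E y - {x}. - 1)"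
    unfolding sum.remove[OF finN x_N] using f(2) w_pos[OF e] by (simp add: insert_commute)
  then have sum_y: "(\<Sum>z\<in>neighbours E y. f z / w {y, z}) = 2 - real (card (neighbours E y))"
    using x_N finN card_pos by (simp add: card_Diff_singleton of_nat_diff)
  show ?thesis
    unfolding \<mu>_def[symmetric] \<nu>_def[symmetric] W
    unfolding \<mu>_def \<nu>_def sum_lazy_measure[OF sg fin xy(1)] sum_lazy_measure[OF sg fin xy(2)]
      sum_x sum_y card_N
    using f(2,3) deg_pos by (simp add: field_simps)
qed

lemma tree_lly_curvature:
  assumes tree: "finite_tree V E" and pos: "positive_metric E w" and e: "e \<in> E"
  shows "lly_curvature V E w e
    = (\<Sum>x\<in>e. (2 - real (card (incident_edges E x))) / (w e * inv_weight_degree E w x))"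
    (is "_ = ?k e")
proof -
  have sg: "simple_graph V E" using tree by (simp add: finite_tree_def)
  have w: "w e > 0" using pos e by (simp add: positive_metric_def)
  have limit: "((\<lambda>\<alpha>. (1 - wasserstein1 V (path_metric V E w)
      (lazy_measure E w \<alpha> x) (lazy_measure E w \<alpha> y) / w e) / (1 - \<alpha>)) \<longlongrightarrow> ?k e) (at_left 1)"
    if xy: "e = {x, y}" for x y
  proof (rule tendsto_eventually)
    have ne: "x \<noteq> y" using edge_facts[OF sg] e xy by blast
    have "\<forall>\<^sub>F \<alpha> in at_left 1. 1 / 2 < \<alpha> \<and> \<alpha> < (1 :: real)"
      using eventually_at_leftI[of "1 / 2" "1 :: real" "\<lambda>\<alpha>. 1 / 2 < \<alpha> \<and> \<alpha> < 1"] by auto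
    then show "\<forall>\<^sub>F \<alpha> in at_left 1. (1 - wasserstein1 V (path_metric V E w)
      (lazy_measure E w \<alpha> x) (lazy_measure E w \<alpha> y) / w e) / (1 - \<alpha>) = ?k e"
    proof eventually_elim
      case (elim \<alpha>)
      define a where "a = (2 - real (card (incident_edges E x))) / inv_weight_degree E w x"
      define b where "b = (2 - real (card (incident_edges E y))) / inv_weight_degree E w y"
      have W: "wasserstein1 V (path_metric V E w) (lazy_measure E w \<alpha> x) (lazy_measure E w \<alpha> y)
          = w e - (1 - \<alpha>) * (a + b)"
        using tree_wasserstein1[OF tree pos, of x y \<alpha>] e xy elim
        by (simp add: a_def b_def algebra_simps diff_divide_distrib)
      have "?k e = (a + b) / w e"
        using ne by (simp add: xy a_def b_def add_divide_distrib mult.commute)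
      then show ?case using elim w by (simp add: W field_simps)
    qed
  qed
  obtain x y where xy: "e = {x, y}"
    using sg e by (auto simp: simple_graph_def card_2_iff)
  show ?thesis
    unfolding lly_curvature_def
  proof (rule the_equality)
    fix k assume "\<forall>x y. e = {x, y} \<longrightarrow> ((\<lambda>\<alpha>. (1 - wasserstein1 V (path_metric V E w)
      (lazy_measure E w \<alpha> x) (lazy_measure E w \<alpha> y) / w e) / (1 - \<alpha>)) \<longlongrightarrow> k) (at_left 1)"
    then show "k = ?k e"
      using xy limit[OF xy] tendsto_unique[OF trivial_limit_at_left_real] by blast
  qed (use limit in blast)
qed

section \<open>Gradient flows of convex functions\<close>

lemma common_limit_at_top:
  fixes a b :: "real \<Rightarrow> real"
  assumes close: "\<And>\<epsilon>. \<epsilon> > 0 \<Longrightarrow> \<exists>s0. \<forall>s\<ge>s0. \<forall>\<^sub>F t in at_top. \<bar>a t - b s\<bar> < \<epsilon>"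
  shows "\<exists>c. (a \<longlongrightarrow> c) at_top \<and> (b \<longlongrightarrow> c) at_top"
proof -
  have "Cauchy (\<lambda>n. a (real n))"
  proof (rule metric_CauchyI)
    fix \<epsilon> :: real assume "\<epsilon> > 0"
    then obtain s where "\<forall>\<^sub>F t in at_top. \<bar>a t - b s\<bar> < \<epsilon> / 2"
      using close[of "\<epsilon> / 2"] by auto
    then obtain T where T: "\<And>t. t \<ge> T \<Longrightarrow> \<bar>a t - b s\<bar> < \<epsilon> / 2"
      by (auto simp: eventually_at_top_linorder)
    obtain M :: nat where "real M \<ge> T" using real_arch_simple by blast
    have "dist (a (real m)) (a (real n)) < \<epsilon>" if "m \<ge> M" "n \<ge> M" for m n
    proof -
      have "\<bar>a (real m) - b s\<bar> < \<epsilon> / 2" "\<bar>a (real n) - b s\<bar> < \<epsilon> / 2"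
        using \<open>real M \<ge> T\<close> that by (auto intro!: T simp del: less_divide_eq_numeral1)
      then show ?thesis unfolding dist_real_def by linarith
    qed
    then show "\<exists>M. \<forall>m\<ge>M. \<forall>n\<ge>M. dist (a (real m)) (a (real n)) < \<epsilon>" by blast
  qed
  then obtain c where c: "(\<lambda>n. a (real n)) \<longlonglongrightarrow> c"
    by (auto simp: Cauchy_convergent_iff convergent_def)
  have near: "\<exists>s0. \<forall>s\<ge>s0. \<bar>b s - c\<bar> \<le> \<epsilon>" if \<epsilon>: "\<epsilon> > 0" for \<epsilon>
  proof -
    obtain s0 where s0: "\<And>s. s \<ge> s0 \<Longrightarrow> \<forall>\<^sub>F t in at_top. \<bar>a t - b s\<bar> < \<epsilon>"
      using close[OF \<epsilon>] by blast
    have "\<bar>b s - c\<bar> \<le> \<epsilon>" if "s \<ge> s0" for s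
    proof -
      have "\<forall>\<^sub>F n in sequentially. \<bar>a (real n) - b s\<bar> \<le> \<epsilon>"
        using eventually_compose_filterlim[OF s0[OF that] filterlim_real_sequentially]
        by (rule eventually_mono) simp
      moreover have "(\<lambda>n. \<bar>a (real n) - b s\<bar>) \<longlonglongrightarrow> \<bar>c - b s\<bar>"
        by (intro tendsto_intros c)
      ultimately have "\<bar>c - b s\<bar> \<le> \<epsilon>"
        by (intro tendsto_upperbound[of _ "\<bar>c - b s\<bar>" sequentially]) simp_all
      then show ?thesis by linarith
    qed
    then show ?thesis by blast
  qed
  have "(b \<longlongrightarrow> c) at_top"
  proof (rule tendstoI)
    fix \<epsilon> :: real assume "\<epsilon> > 0"
    then obtain s0 where "\<forall>s\<ge>s0. \<bar>b s - c\<bar> \<le> \<epsilon> / 2" using near[of "\<epsilon> / 2"] by auto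
    then show "\<forall>\<^sub>F s in at_top. dist (b s) c < \<epsilon>"
      using \<open>\<epsilon> > 0\<close> unfolding eventually_at_top_linorder dist_real_def
      by (intro exI[of _ s0]) fastforce
  qed
  moreover have "(a \<longlongrightarrow> c) at_top"
  proof (rule tendstoI)
    fix \<epsilon> :: real assume "\<epsilon> > 0"
    then obtain s0 s1 where "\<forall>s\<ge>s0. \<bar>b s - c\<bar> \<le> \<epsilon> / 2"
      "\<forall>s\<ge>s1. \<forall>\<^sub>F t in at_top. \<bar>a t - b s\<bar> < \<epsilon> / 2"
      using near[of "\<epsilon> / 2"] close[of "\<epsilon> / 2"] by auto
    then have b: "\<bar>b (max s0 s1) - c\<bar> \<le> \<epsilon> / 2"
      and "\<forall>\<^sub>F t in at_top. \<bar>a t - b (max s0 s1)\<bar> < \<epsilon> / 2"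
      by auto
    from this(2) show "\<forall>\<^sub>F t in at_top. dist (a t) c < \<epsilon>"
    proof eventually_elim
      case (elim t)
      then show ?case using b unfolding dist_real_def by linarith
    qed
  qed
  ultimately show ?thesis by blast
qed

lemma gradient_norm_antimono:
  fixes x g :: "real \<Rightarrow> 'i \<Rightarrow> real"
  assumes deriv: "\<And>t i. t > 0 \<Longrightarrow> i \<in> I \<Longrightarrow> ((\<lambda>t. x t i) has_real_derivative - g t i) (at t)"
    and monotone: "\<And>s t. s > 0 \<Longrightarrow> t > 0 \<Longrightarrow> (\<Sum>i\<in>I. (g t i - g s i) * (x t i - x s i)) \<ge> 0"
    and st: "0 < s" "s \<le> t"
  shows "(\<Sum>i\<in>I. (g t i)\<^sup>2) \<le> (\<Sum>i\<in>I. (g s i)\<^sup>2)"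
proof -
  define A where "A h r = (\<Sum>i\<in>I. (x (r + h) i - x r i)\<^sup>2)" for h r
  have A_le: "A h t \<le> A h s" if "h > 0" for h
  proof (rule DERIV_nonpos_imp_nonincreasing[OF st(2)])
    fix r assume "s \<le> r" "r \<le> t"
    then have r: "r > 0" "r + h > 0" using st that by auto
    have shift: "((\<lambda>r. x (r + h) i) has_real_derivative - g (r + h) i) (at r)" if "i \<in> I" for i
      using deriv[OF r(2) that] by (simp add: DERIV_shift)
    have "(A h has_real_derivative
        (\<Sum>i\<in>I. - 2 * ((g (r + h) i - g r i) * (x (r + h) i - x r i)))) (at r)"
      unfolding A_def
      by (rule DERIV_sum) (auto intro!: derivative_eq_intros shift deriv r simp: algebra_simps)
    moreover have "(\<Sum>i\<in>I. - 2 * ((g (r + h) i - g r i) * (x (r + h) i - x r i))) \<le> 0"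
      using monotone[OF r] unfolding sum_distrib_left[symmetric] by linarith
    ultimately show "\<exists>y. (A h has_real_derivative y) (at r) \<and> y \<le> 0" by blast
  qed
  have lim: "((\<lambda>h. A h r / h\<^sup>2) \<longlongrightarrow> (\<Sum>i\<in>I. (g r i)\<^sup>2)) (at_right 0)" if "r > 0" for r
  proof -
    have "((\<lambda>h. \<Sum>i\<in>I. ((x (r + h) i - x r i) / h)\<^sup>2) \<longlongrightarrow> (\<Sum>i\<in>I. (- g r i)\<^sup>2)) (at_right 0)"
    proof (intro tendsto_sum tendsto_power)
      fix i assume "i \<in> I"
      then have "((\<lambda>h. (x (r + h) i - x r i) / h) \<longlongrightarrow> - g r i) (at 0)"
        using deriv[OF that] by (simp add: DERIV_def)
      then show "((\<lambda>h. (x (r + h) i - x r i) / h) \<longlongrightarrow> - g r i) (at_right 0)"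
        by (rule tendsto_within_subset) simp
    qed
    then show ?thesis by (simp add: A_def sum_divide_distrib power_divide)
  qed
  show ?thesis
  proof (rule tendsto_le[OF _ lim lim])
    show "\<forall>\<^sub>F h in at_right 0. A h t / h\<^sup>2 \<le> A h s / h\<^sup>2"
      using eventually_at_right_less by eventually_elim (simp add: A_le divide_right_mono)
  qed (use st in auto)
qed

lemma convex_gradient_flow_limits:
  fixes x g :: "real \<Rightarrow> 'i \<Rightarrow> real" and \<phi> :: "real \<Rightarrow> real"
  assumes fin: "finite I"
    and deriv: "\<And>t i. t > 0 \<Longrightarrow> i \<in> I \<Longrightarrow> ((\<lambda>t. x t i) has_real_derivative - g t i) (at t)"
    and energy: "\<And>t. t > 0 \<Longrightarrow> (\<phi> has_real_derivative - (\<Sum>i\<in>I. (g t i)\<^sup>2)) (at t)"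
    and convex: "\<And>s t. s > 0 \<Longrightarrow> t > 0 \<Longrightarrow> \<phi> s + (\<Sum>i\<in>I. g s i * (x t i - x s i)) \<le> \<phi> t"
  shows "\<exists>c. \<forall>i\<in>I. ((\<lambda>t. g t i) \<longlongrightarrow> c i) at_top \<and> ((\<lambda>t. x t i / t) \<longlongrightarrow> - c i) at_top"
proof -
  define N where "N t = (\<Sum>i\<in>I. (g t i)\<^sup>2)" for t
  define q where "q s t i = (x s i - x t i) / (t - s)" for s t i
  have monotone: "(\<Sum>i\<in>I. (g t i - g s i) * (x t i - x s i)) \<ge> 0" if "s > 0" "t > 0" for s t
  proof -
    have "(\<Sum>i\<in>I. (g t i - g s i) * (x t i - x s i))
        = - ((\<Sum>i\<in>I. g s i * (x t i - x s i)) + (\<Sum>i\<in>I. g t i * (x s i - x t i)))"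
      unfolding sum.distrib[symmetric] sum_negf[symmetric] by (rule sum.cong) (auto simp: algebra_simps)
    then show ?thesis using convex[OF that] convex[OF that(2,1)] by linarith
  qed
  have N_mono: "N t \<le> N s" if "0 < s" "s \<le> t" for s t
    unfolding N_def using gradient_norm_antimono[OF deriv monotone that] .
  have N_nonneg: "N t \<ge> 0" for t by (simp add: N_def sum_nonneg)
  define L where "L = Inf (N ` {0<..})"
  have L_le: "L \<le> N s" if "s > 0" for s
    unfolding L_def using that by (intro cInf_lower bdd_belowI2[of _ 0]) (auto simp: N_nonneg)
  have L_approx: "\<exists>s>0. N s < L + \<epsilon>" if "\<epsilon> > 0" for \<epsilon>
    using cInf_lessD[of "N ` {0<..}" "L + \<epsilon>"] that by (auto simp: L_def)
  have q_le: "(\<Sum>i\<in>I. (q s t i)\<^sup>2) \<le> N s" if st: "0 < s" "s < t" for s t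
  proof -
    have "\<exists>z>s. z < t \<and> (\<Sum>i\<in>I. q s t i * x t i) - (\<Sum>i\<in>I. q s t i * x s i)
        = (t - s) * (\<Sum>i\<in>I. q s t i * - g z i)"
      by (rule MVT2[OF st(2)]) (use st in \<open>auto intro!: derivative_eq_intros deriv simp: field_simps\<close>)
    then obtain z where z: "s < z" "z < t" "(\<Sum>i\<in>I. q s t i * x t i) - (\<Sum>i\<in>I. q s t i * x s i)
        = (t - s) * (\<Sum>i\<in>I. q s t i * - g z i)" by blast
    have "(t - s) * (\<Sum>i\<in>I. (q s t i)\<^sup>2) = (\<Sum>i\<in>I. q s t i * x s i) - (\<Sum>i\<in>I. q s t i * x t i)"
      unfolding sum_distrib_left sum_subtractf[symmetric]
      by (rule sum.cong) (use st in \<open>auto simp: q_def power2_eq_square divide_simps algebra_simps\<close>)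
    also have "\<dots> = (t - s) * (\<Sum>i\<in>I. q s t i * g z i)" using z(3) by (simp add: sum_negf)
    finally have "(\<Sum>i\<in>I. (q s t i)\<^sup>2) = (\<Sum>i\<in>I. q s t i * g z i)" using st by simp
    moreover have "2 * (\<Sum>i\<in>I. q s t i * g z i) \<le> (\<Sum>i\<in>I. (q s t i)\<^sup>2) + N z"
      unfolding N_def sum_distrib_left sum.distrib[symmetric]
      by (rule sum_mono) (use sum_squares_bound in \<open>simp add: mult.assoc\<close>)
    ultimately have "(\<Sum>i\<in>I. (q s t i)\<^sup>2) \<le> N z" by linarith
    also have "\<dots> \<le> N s" using N_mono st z by simp
    finally show ?thesis .
  qed
  have g_q: "L \<le> (\<Sum>i\<in>I. g s i * q s t i)" if st: "0 < s" "s < t" for s t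
  proof -
    have "\<exists>z>s. z < t \<and> \<phi> t - \<phi> s = (t - s) * - N z"
      by (rule MVT2[OF st(2)]) (use st energy in \<open>auto simp: N_def\<close>)
    then obtain z where z: "s < z" "z < t" "\<phi> t - \<phi> s = (t - s) * - N z" by blast
    have "(t - s) * L \<le> (t - s) * N z" using st z L_le[of z] by (intro mult_left_mono) auto
    also have "\<dots> = \<phi> s - \<phi> t" using z(3) by simp
    also have "\<dots> \<le> - (\<Sum>i\<in>I. g s i * (x t i - x s i))" using convex[of s t] st by simp
    also have "\<dots> = (t - s) * (\<Sum>i\<in>I. g s i * q s t i)"
      unfolding sum_distrib_left sum_negf[symmetric]
      by (rule sum.cong) (use st in \<open>auto simp: q_def divide_simps algebra_simps\<close>)
    finally show ?thesis using st by simp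
  qed
  have dist_le: "(g s i - q s t i)\<^sup>2 \<le> 2 * (N s - L)" if st: "0 < s" "s < t" and i: "i \<in> I" for s t i
  proof -
    have "(g s i - q s t i)\<^sup>2 \<le> (\<Sum>i\<in>I. (g s i - q s t i)\<^sup>2)"
      using fin i by (intro member_le_sum) auto
    also have "\<dots> = N s + (\<Sum>i\<in>I. (q s t i)\<^sup>2) - 2 * (\<Sum>i\<in>I. g s i * q s t i)"
      by (simp add: N_def power2_diff sum.distrib sum_subtractf sum_distrib_left mult.assoc)
    also have "\<dots> \<le> N s + N s - 2 * L"
      by (intro diff_mono add_mono mult_left_mono q_le[OF st] g_q[OF st]) simp_all
    also have "\<dots> = 2 * (N s - L)" by simp
    finally show ?thesis .
  qed
  have "\<exists>c. ((\<lambda>t. - (x t i / t)) \<longlongrightarrow> c) at_top \<and> ((\<lambda>t. g t i) \<longlongrightarrow> c) at_top" if i: "i \<in> I" for i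
  proof (rule common_limit_at_top)
    fix \<epsilon> :: real assume \<epsilon>: "\<epsilon> > 0"
    then obtain s0 where s0: "s0 > 0" "N s0 < L + (\<epsilon> / 2)\<^sup>2 / 2"
      using L_approx[of "(\<epsilon> / 2)\<^sup>2 / 2"] by auto
    have "\<forall>\<^sub>F t in at_top. \<bar>- (x t i / t) - g s i\<bar> < \<epsilon>" if s: "s \<ge> s0" for s
    proof -
      have gq: "\<bar>g s i - q s t i\<bar> < \<epsilon> / 2" if "t > s" for t
      proof -
        have "(g s i - q s t i)\<^sup>2 < (\<epsilon> / 2)\<^sup>2"
          using dist_le[OF _ that i] s s0 N_mono[of s0 s] by simp
        then show ?thesis using \<epsilon> by (intro power2_less_imp_less[of _ "\<epsilon> / 2"]) auto
      qed
      define K where "K = s * (\<bar>g s i\<bar> + \<epsilon> / 2) + \<bar>x s i\<bar>"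
      have "((\<lambda>t. K / t) \<longlongrightarrow> 0) at_top" by (intro tendsto_divide_0[OF tendsto_const] filterlim_at_top_imp_at_infinity filterlim_ident)
      then have "\<forall>\<^sub>F t in at_top. K / t < \<epsilon> / 2"
        using \<epsilon> by (intro order_tendstoD) auto
      then show ?thesis using eventually_gt_at_top[of s]
      proof eventually_elim
        case (elim t)
        then have t: "t > 0" using s s0 by simp
        have "\<bar>s * q s t i + x s i\<bar> \<le> \<bar>s * q s t i\<bar> + \<bar>x s i\<bar>" by (rule abs_triangle_ineq)
        also have "\<dots> \<le> K"
        proof -
          have "\<bar>q s t i\<bar> \<le> \<bar>g s i\<bar> + \<epsilon> / 2" using gq[OF elim(2)] by linarith
          then show ?thesis
            unfolding K_def abs_mult using s s0 by (intro add_mono mult_mono) auto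
        qed
        finally have "\<bar>(s * q s t i + x s i) / t\<bar> \<le> K / t"
          using t by (simp add: abs_divide divide_right_mono)
        moreover have "- (x t i / t) - q s t i = - ((s * q s t i + x s i) / t)"
          using t elim(2) by (simp add: q_def divide_simps) (simp add: algebra_simps)
        ultimately show ?case using elim gq[of t] by linarith
      qed
    qed
    then show "\<exists>s0. \<forall>s\<ge>s0. \<forall>\<^sub>F t in at_top. \<bar>- (x t i / t) - g s i\<bar> < \<epsilon>" by blast
  qed
  then obtain c where c: "\<And>i. i \<in> I \<Longrightarrow> ((\<lambda>t. - (x t i / t)) \<longlongrightarrow> c i) at_top"
      "\<And>i. i \<in> I \<Longrightarrow> ((\<lambda>t. g t i) \<longlongrightarrow> c i) at_top" by metis
  have "((\<lambda>t. x t i / t) \<longlongrightarrow> - c i) at_top" if "i \<in> I" for i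
    using tendsto_minus[OF c(1)[OF that]] by simp
  with c(2) show ?thesis by blast
qed

section \<open>The curvature flow\<close>

definition tree_curvature :: "'a set set \<Rightarrow> ('a set \<Rightarrow> real) \<Rightarrow> 'a set \<Rightarrow> real" where
  "tree_curvature E w e =
     (\<Sum>x\<in>e. (2 - real (card (incident_edges E x))) / (w e * inv_weight_degree E w x))"

definition curvature_potential :: "'a set set \<Rightarrow> ('a set \<Rightarrow> real) \<Rightarrow> real" where
  "curvature_potential E w =
     (\<Sum>x\<in>\<Union>E. (real (card (incident_edges E x)) - 2) * ln (inv_weight_degree E w x))"

lemma tree_curvature_scale:
  assumes "s \<noteq> 0"
  shows "tree_curvature E (\<lambda>e. w e / s) e = tree_curvature E w e"
proof -
  have "inv_weight_degree E (\<lambda>e. w e / s) x = s * inv_weight_degree E w x" for x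
    by (simp add: inv_weight_degree_def sum_distrib_left)
  then show ?thesis using assms by (simp add: tree_curvature_def)
qed

lemma sum_tree_curvature:
  assumes fin: "finite E" "finite (\<Union>E)"
  shows "(\<Sum>e\<in>E. tree_curvature E w e * h e)
    = (\<Sum>x\<in>\<Union>E. \<Sum>e\<in>incident_edges E x.
        (2 - real (card (incident_edges E x))) / (w e * inv_weight_degree E w x) * h e)"
proof -
  have "{x \<in> \<Union>E. x \<in> e} = e" if "e \<in> E" for e using that by auto
  then have "(\<Sum>e\<in>E. tree_curvature E w e * h e) = (\<Sum>e\<in>E. \<Sum>x\<in>{x \<in> \<Union>E. x \<in> e}.
      (2 - real (card (incident_edges E x))) / (w e * inv_weight_degree E w x) * h e)"
    by (simp add: tree_curvature_def sum_distrib_right cong: sum.cong)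
  also have "\<dots> = (\<Sum>x\<in>\<Union>E. \<Sum>e\<in>incident_edges E x.
      (2 - real (card (incident_edges E x))) / (w e * inv_weight_degree E w x) * h e)"
    unfolding incident_edges_def by (rule sum.swap_restrict[OF fin])
  finally show ?thesis .
qed

lemma log_inv_weight_degree_convex:
  assumes fin: "finite E" and ne: "incident_edges E x \<noteq> {}"
    and w: "positive_metric E w" and w': "positive_metric E w'"
  shows "ln (inv_weight_degree E w x)
      - (\<Sum>e\<in>incident_edges E x. 1 / (w e * inv_weight_degree E w x) * (ln (w' e) - ln (w e)))
    \<le> ln (inv_weight_degree E w' x)"
proof -
  define I where "I = incident_edges E x"
  define D where "D = inv_weight_degree E w x"
  define p where "p e = 1 / (w e * D)" for e
  have I: "finite I" "I \<noteq> {}" using fin ne by (auto simp: I_def incident_edges_def)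
  have D: "D > 0" "inv_weight_degree E w' x > 0"
    unfolding D_def using inv_weight_degree_pos[OF fin _ ne] w w' by auto
  have pos: "w e > 0" "w' e > 0" if "e \<in> I" for e
    using that w w' by (auto simp: I_def incident_edges_def positive_metric_def)
  have sum_I: "inv_weight_degree E v x = (\<Sum>e\<in>I. 1 / v e)" for v
    by (simp add: I_def inv_weight_degree_def incident_edges_def)
  have p: "(\<Sum>e\<in>I. p e) = 1"
  proof -
    have "(\<Sum>e\<in>I. p e) = (\<Sum>e\<in>I. 1 / w e) / D"
      unfolding p_def sum_divide_distrib by simp
    then show ?thesis using D by (simp add: D_def flip: sum_I)
  qed
  have "exp (\<Sum>e\<in>I. p e * (ln (w e) - ln (w' e))) \<le> (\<Sum>e\<in>I. p e * exp (ln (w e) - ln (w' e)))"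
    using convex_on_sum[OF I exp_convex p, of "\<lambda>e. ln (w e) - ln (w' e)"] D pos
    by (simp add: p_def less_imp_le)
  also have "\<dots> = (\<Sum>e\<in>I. 1 / w' e / D)"
  proof (rule sum.cong)
    fix e assume "e \<in> I"
    from pos[OF this] show "p e * exp (ln (w e) - ln (w' e)) = 1 / w' e / D"
      by (simp add: p_def exp_diff)
  qed simp
  also have "\<dots> = inv_weight_degree E w' x / D"
    by (simp only: sum_divide_distrib sum_I)
  finally have "(\<Sum>e\<in>I. p e * (ln (w e) - ln (w' e))) \<le> ln (inv_weight_degree E w' x / D)"
    using D by (simp add: ln_ge_iff)
  then have "ln D - (\<Sum>e\<in>I. p e * (ln (w' e) - ln (w e))) \<le> ln (inv_weight_degree E w' x)"
    using D by (simp add: ln_div right_diff_distrib sum_subtractf)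
  then show ?thesis by (simp only: p_def I_def D_def)
qed

text \<open>
  In the coordinates \<open>ln w\<^sub>e\<close> the curvature is the gradient of the potential, and the potential is
  convex: a leaf contributes a linear function, any other vertex a nonnegative multiple of a
  log-sum-exp function.
\<close>

lemma curvature_potential_convex:
  assumes fin: "finite E" "finite (\<Union>E)" and w: "positive_metric E w" and w': "positive_metric E w'"
  shows "curvature_potential E w + (\<Sum>e\<in>E. tree_curvature E w e * (ln (w' e) - ln (w e)))
    \<le> curvature_potential E w'"
  unfolding curvature_potential_def sum_tree_curvature[OF fin] sum.distrib[symmetric]
proof (rule sum_mono)
  fix x assume "x \<in> \<Union>E"
  then have ne: "incident_edges E x \<noteq> {}" by (auto simp: incident_edges_def)
  define I where "I = incident_edges E x"
  define D where "D = inv_weight_degree E w x"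
  define n where "n = real (card I) - 2"
  have finI: "finite I" using fin by (simp add: I_def incident_edges_def)
  have "n * ln D - n * (\<Sum>e\<in>I. 1 / (w e * D) * (ln (w' e) - ln (w e)))
      \<le> n * ln (inv_weight_degree E w' x)"
  proof (cases "card I = 1")
    case True
    then obtain e where e: "I = {e}" by (auto simp: card_1_singleton_iff)
    then have "e \<in> E" by (auto simp: I_def incident_edges_def)
    then have "w e > 0" "w' e > 0" using w w' by (auto simp: positive_metric_def)
    moreover have "inv_weight_degree E v x = 1 / v e" for v
      using e by (simp add: inv_weight_degree_def I_def incident_edges_def)
    ultimately show ?thesis using e by (simp add: n_def D_def ln_div)
  next
    case False
    have "card I \<noteq> 0" using ne finI by (simp add: I_def)
    then have "n \<ge> 0" using False by (simp add: n_def)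
    from mult_left_mono[OF log_inv_weight_degree_convex[OF fin(1) ne w w'] this]
    show ?thesis by (simp add: D_def I_def right_diff_distrib)
  qed
  moreover have "(\<Sum>e\<in>I. (2 - real (card I)) / (w e * D) * (ln (w' e) - ln (w e)))
      = - (n * (\<Sum>e\<in>I. 1 / (w e * D) * (ln (w' e) - ln (w e))))"
    unfolding sum_distrib_left sum_negf[symmetric]
    by (rule sum.cong) (auto simp: n_def diff_divide_distrib algebra_simps)
  ultimately show "(real (card (incident_edges E x)) - 2) * ln (inv_weight_degree E w x)
      + (\<Sum>e\<in>incident_edges E x. (2 - real (card (incident_edges E x)))
          / (w e * inv_weight_degree E w x) * (ln (w' e) - ln (w e)))
    \<le> (real (card (incident_edges E x)) - 2) * ln (inv_weight_degree E w' x)"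
    by (simp only: I_def D_def n_def)
qed

lemma curvature_potential_decrease:
  assumes fin: "finite E" "finite (\<Union>E)" and pos: "positive_metric E (W t)"
    and flow: "\<And>e. e \<in> E \<Longrightarrow>
      ((\<lambda>s. W s e) has_real_derivative - tree_curvature E (W t) e * W t e) (at t)"
  shows "((\<lambda>s. curvature_potential E (W s)) has_real_derivative
    - (\<Sum>e\<in>E. (tree_curvature E (W t) e)\<^sup>2)) (at t)"
proof -
  let ?\<kappa> = "tree_curvature E (W t)"
  have w: "W t e > 0" if "e \<in> E" for e using pos that by (simp add: positive_metric_def)
  have D': "((\<lambda>s. inv_weight_degree E (W s) x) has_real_derivative
      (\<Sum>e\<in>incident_edges E x. ?\<kappa> e / W t e)) (at t)" for x
    unfolding inv_weight_degree_def incident_edges_def[symmetric]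
  proof (rule DERIV_sum)
    fix e assume "e \<in> incident_edges E x"
    then have "e \<in> E" by (simp add: incident_edges_def)
    then show "((\<lambda>s. 1 / W s e) has_real_derivative ?\<kappa> e / W t e) (at t)"
      using w[of e] by (auto intro!: derivative_eq_intros flow simp: field_simps)
  qed
  have "((\<lambda>s. curvature_potential E (W s)) has_real_derivative
      (\<Sum>x\<in>\<Union>E. (real (card (incident_edges E x)) - 2)
        * ((\<Sum>e\<in>incident_edges E x. ?\<kappa> e / W t e) / inv_weight_degree E (W t) x))) (at t)"
    unfolding curvature_potential_def
  proof (rule DERIV_sum)
    fix x assume "x \<in> \<Union>E"
    then have "inv_weight_degree E (W t) x > 0"
      by (intro inv_weight_degree_pos fin pos) (auto simp: incident_edges_def)
    then show "((\<lambda>s. (real (card (incident_edges E x)) - 2) * ln (inv_weight_degree E (W s) x))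
        has_real_derivative (real (card (incident_edges E x)) - 2)
        * ((\<Sum>e\<in>incident_edges E x. ?\<kappa> e / W t e) / inv_weight_degree E (W t) x)) (at t)"
      by (auto intro!: derivative_eq_intros D' simp: field_simps)
  qed
  also have "(\<Sum>x\<in>\<Union>E. (real (card (incident_edges E x)) - 2)
        * ((\<Sum>e\<in>incident_edges E x. ?\<kappa> e / W t e) / inv_weight_degree E (W t) x))
      = - (\<Sum>e\<in>E. ?\<kappa> e * ?\<kappa> e)"
    unfolding sum_tree_curvature[OF fin] sum_negf[symmetric] sum_divide_distrib sum_distrib_left
    by (intro sum.cong refl) (simp add: field_simps diff_divide_distrib)
  finally show ?thesis by (simp add: power2_eq_square)
qed

lemma ln_sum_growth_rate:
  fixes W :: "real \<Rightarrow> 'i \<Rightarrow> real"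
  assumes I: "finite I" "I \<noteq> {}" and pos: "\<And>t i. t \<ge> 0 \<Longrightarrow> i \<in> I \<Longrightarrow> W t i > 0"
    and rate: "\<And>i. i \<in> I \<Longrightarrow> ((\<lambda>t. ln (W t i) / t) \<longlongrightarrow> r i) at_top"
  shows "((\<lambda>t. ln (\<Sum>i\<in>I. W t i) / t) \<longlongrightarrow> Max (r ` I)) at_top"
proof (rule order_tendstoI)
  have fin: "finite (r ` I)" "r ` I \<noteq> {}" using I by auto
  fix a assume "a < Max (r ` I)"
  then obtain j where j: "j \<in> I" "a < r j" using fin by (auto simp: Max_gr_iff)
  from order_tendstoD(1)[OF rate[OF j(1)] j(2)] eventually_gt_at_top[of 0]
  show "\<forall>\<^sub>F t in at_top. a < ln (\<Sum>i\<in>I. W t i) / t"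
  proof eventually_elim
    case (elim t)
    have "W t j \<le> (\<Sum>i\<in>I. W t i)"
      using I j elim pos by (intro member_le_sum) (auto intro: less_imp_le)
    then have "ln (W t j) \<le> ln (\<Sum>i\<in>I. W t i)"
      using pos[of t j] j elim by (intro ln_mono) auto
    then have "ln (W t j) / t \<le> ln (\<Sum>i\<in>I. W t i) / t" using elim by (intro divide_right_mono) auto
    then show ?case using elim by linarith
  qed
next
  have fin: "finite (r ` I)" "r ` I \<noteq> {}" using I by auto
  fix a assume a: "Max (r ` I) < a"
  define m where "m = (Max (r ` I) + a) / 2"
  have m: "Max (r ` I) < m" "m < a" using a by (auto simp: m_def field_simps)
  have "\<forall>\<^sub>F t in at_top. \<forall>i\<in>I. ln (W t i) / t < m"
    using I(1)
  proof (rule eventually_ball_finite, intro ballI)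
    fix i assume "i \<in> I"
    then show "\<forall>\<^sub>F t in at_top. ln (W t i) / t < m"
      using m(1) fin by (intro order_tendstoD(2)[OF rate]) auto
  qed
  moreover have "((\<lambda>t. ln (real (card I)) / t) \<longlongrightarrow> 0) at_top"
    by (intro tendsto_divide_0[OF tendsto_const] filterlim_at_top_imp_at_infinity filterlim_ident)
  then have "\<forall>\<^sub>F t in at_top. ln (real (card I)) / t < a - m"
    using m by (intro order_tendstoD(2)) auto
  ultimately show "\<forall>\<^sub>F t in at_top. ln (\<Sum>i\<in>I. W t i) / t < a"
    using eventually_gt_at_top[of 0]
  proof eventually_elim
    case (elim t)
    have card: "real (card I) > 0" using I by (simp add: card_gt_0_iff)
    have le: "W t i \<le> exp (m * t)" if "i \<in> I" for i
    proof -
      have "ln (W t i) < m * t" using elim that by (simp add: pos_divide_less_eq)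
      then show ?thesis using pos[of t i] that elim by (metis exp_le_cancel_iff exp_ln less_imp_le)
    qed
    have "(\<Sum>i\<in>I. W t i) \<le> real (card I) * exp (m * t)"
      using sum_mono[OF le] by simp
    moreover have "(\<Sum>i\<in>I. W t i) > 0" using I pos elim by (intro sum_pos) auto
    ultimately have "ln (\<Sum>i\<in>I. W t i) \<le> ln (real (card I) * exp (m * t))" by (intro ln_mono) auto
    also have "\<dots> = ln (real (card I)) + m * t" using card by (simp add: ln_mult)
    finally have "ln (\<Sum>i\<in>I. W t i) / t \<le> ln (real (card I)) / t + m"
      using elim by (simp add: field_simps)
    then show ?case using elim by linarith
  qed
qed

lemma exponential_bound:
  fixes f :: "real \<Rightarrow> real"
  assumes pos: "\<And>t. t \<ge> 0 \<Longrightarrow> f t > 0" and le: "\<And>t. t \<ge> 0 \<Longrightarrow> f t \<le> 1"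
    and rate: "((\<lambda>t. ln (f t) / t) \<longlongrightarrow> r) at_top" and r: "r < 0"
  shows "\<exists>C>0. \<exists>\<delta>>0. \<forall>t\<ge>0. f t \<le> C * exp (- \<delta> * t)"
proof -
  define \<delta> where "\<delta> = - r / 2"
  have \<delta>: "\<delta> > 0" "r < - \<delta>" using r by (auto simp: \<delta>_def)
  obtain T0 where T0: "\<And>t. t \<ge> T0 \<Longrightarrow> ln (f t) / t < - \<delta>"
    using order_tendstoD(2)[OF rate \<delta>(2)] by (auto simp: eventually_at_top_linorder)
  define T where "T = max T0 1"
  have "f t \<le> exp (\<delta> * T) * exp (- \<delta> * t)" if t: "t \<ge> 0" for t
  proof (cases "t \<ge> T")
    case True
    then have "t > 0" "ln (f t) / t < - \<delta>" using T0 by (auto simp: T_def)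
    then have "ln (f t) < - \<delta> * t" by (simp add: pos_divide_less_eq)
    then have "f t \<le> exp (- \<delta> * t)" using pos[OF t] by (metis exp_le_cancel_iff exp_ln less_imp_le)
    also have "\<dots> \<le> exp (\<delta> * T) * exp (- \<delta> * t)" using \<delta> by (simp add: T_def)
    finally show ?thesis .
  next
    case False
    then have "1 \<le> exp (\<delta> * T + - \<delta> * t)" using \<delta> by (simp add: mult_left_mono)
    then show ?thesis using le[OF t] by (simp only: exp_add)
  qed
  then show ?thesis using \<delta> by (intro exI[of _ "exp (\<delta> * T)"] conjI exI[of _ \<delta>]) auto
qed

theorem theorem1p2:
  fixes V :: "'a set" and E :: "'a set set"
    and W w :: "real \<Rightarrow> 'a set \<Rightarrow> real"
  assumes tree: "finite_tree V E"
    and edge: "E \<noteq> {}"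
    and flow: "unnormalized_flow_solution V E W"
    and normalization: "\<And>t. t \<ge> 0 \<Longrightarrow> w t = normalized_metric E (W t)"
  shows "(\<forall>t\<ge>0. \<forall>e\<in>E. lly_curvature V E (w t) e = lly_curvature V E (W t) e) \<and>
    (\<exists>c :: 'a set \<Rightarrow> real.
       (\<forall>e\<in>E. ((\<lambda>t. lly_curvature V E (W t) e) \<longlongrightarrow> c e) at_top) \<and>
       (let c_star = Min (c ` E); E_star = {e\<in>E. c e = c_star} in
          (\<forall>e\<in>E. ((\<lambda>t. 1 / t * ln (W t e)) \<longlongrightarrow> - c e) at_top) \<and>
          (\<forall>e\<in>E. ((\<lambda>t. 1 / t * ln (w t e)) \<longlongrightarrow> c_star - c e) at_top) \<and>
          (\<forall>e\<in>E - E_star. \<exists>C>0. \<exists>\<delta>>0. \<forall>t\<ge>0. w t e \<le> C * exp (- \<delta> * t))))"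
proof -
  have finE: "finite E" using finite_tree_edges[OF tree] .
  have finU: "finite (\<Union>E)"
    using tree by (auto simp: finite_tree_def simple_graph_def intro: finite_subset[of _ V])
  define S where "S t = (\<Sum>e\<in>E. W t e)" for t
  have W_metric: "positive_metric E (W t)" if "t \<ge> 0" for t
    using flow that by (simp add: unnormalized_flow_solution_def)
  have W_pos: "W t e > 0" if "t \<ge> 0" "e \<in> E" for t e
    using W_metric[OF that(1)] that(2) by (simp add: positive_metric_def)
  have S_pos: "S t > 0" if "t \<ge> 0" for t
    unfolding S_def using finE edge W_pos[OF that] by (intro sum_pos) auto
  have w_eq: "w t = (\<lambda>e. W t e / S t)" if "t \<ge> 0" for t
    using normalization[OF that] by (simp add: normalized_metric_def S_def fun_eq_iff)
  have w_pos: "w t e > 0" if "t \<ge> 0" "e \<in> E" for t e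
    using W_pos[OF that] S_pos[OF that(1)] by (simp add: w_eq[OF that(1)])
  have w_le: "w t e \<le> 1" if t: "t \<ge> 0" and e: "e \<in> E" for t e
    using member_le_sum[OF e, of "W t"] W_pos[OF t] S_pos[OF t] finE
    by (simp add: w_eq[OF t] S_def less_imp_le)
  have curvature: "lly_curvature V E v e = tree_curvature E v e"
    if "positive_metric E v" "e \<in> E" for v e
    unfolding tree_curvature_def using tree_lly_curvature[OF tree that] .
  have scale: "lly_curvature V E (w t) e = lly_curvature V E (W t) e" if "t \<ge> 0" "e \<in> E" for t e
  proof -
    have "positive_metric E (w t)" using w_pos[OF that(1)] by (simp add: positive_metric_def)
    then show ?thesis
      using curvature[OF _ that(2)] W_metric[OF that(1)] tree_curvature_scale[of "S t" E "W t" e] S_pos[OF that(1)]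
      by (simp add: w_eq[OF that(1)])
  qed
  have deriv: "((\<lambda>s. W s e) has_real_derivative - tree_curvature E (W t) e * W t e) (at t)"
    if "t > 0" "e \<in> E" for t e
  proof -
    have "((\<lambda>s. W s e) has_real_derivative - lly_curvature V E (W t) e * W t e) (at t within {0..})"
      using flow that by (simp add: unnormalized_flow_solution_def)
    moreover have "at t within {0..} = at t"
      using that by (intro at_within_interior) (simp add: interior_Ici)
    ultimately show ?thesis using curvature[OF W_metric that(2)] that(1) by simp
  qed
  have "\<exists>c. \<forall>e\<in>E. ((\<lambda>t. tree_curvature E (W t) e) \<longlongrightarrow> c e) at_top \<and>
      ((\<lambda>t. ln (W t e) / t) \<longlongrightarrow> - c e) at_top"
  proof (rule convex_gradient_flow_limits[OF finE])
    fix t :: real and e assume t: "t > 0" and e: "e \<in> E"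
    show "((\<lambda>t. ln (W t e)) has_real_derivative - tree_curvature E (W t) e) (at t)"
      using W_pos[of t e] t e by (auto intro!: derivative_eq_intros deriv simp: field_simps)
  next
    fix t :: real assume "t > 0"
    then show "((\<lambda>t. curvature_potential E (W t)) has_real_derivative
        - (\<Sum>e\<in>E. (tree_curvature E (W t) e)\<^sup>2)) (at t)"
      by (intro curvature_potential_decrease finE finU W_metric deriv) auto
  next
    fix s t :: real assume "s > 0" "t > 0"
    then show "curvature_potential E (W s)
        + (\<Sum>e\<in>E. tree_curvature E (W s) e * (ln (W t e) - ln (W s e)))
      \<le> curvature_potential E (W t)"
      by (intro curvature_potential_convex finE finU W_metric) auto
  qed
  then obtain c where c: "\<And>e. e \<in> E \<Longrightarrow> ((\<lambda>t. tree_curvature E (W t) e) \<longlongrightarrow> c e) at_top"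
    and W_rate: "\<And>e. e \<in> E \<Longrightarrow> ((\<lambda>t. ln (W t e) / t) \<longlongrightarrow> - c e) at_top"
    by blast
  have c_lim: "((\<lambda>t. lly_curvature V E (W t) e) \<longlongrightarrow> c e) at_top" if "e \<in> E" for e
  proof (rule Lim_transform_eventually[OF c[OF that]])
    show "\<forall>\<^sub>F t in at_top. tree_curvature E (W t) e = lly_curvature V E (W t) e"
      using eventually_ge_at_top[of 0] by eventually_elim (simp add: curvature W_metric that)
  qed
  have "Max ((\<lambda>e. - c e) ` E) = - Min (c ` E)"
    using finE edge minus_Min_eq_Max[of "c ` E"] by (simp add: image_image)
  then have S_rate: "((\<lambda>t. ln (S t) / t) \<longlongrightarrow> - Min (c ` E)) at_top"
    unfolding S_def using ln_sum_growth_rate[of E W "\<lambda>e. - c e", OF finE edge W_pos W_rate] by simp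
  have w_rate: "((\<lambda>t. ln (w t e) / t) \<longlongrightarrow> Min (c ` E) - c e) at_top" if "e \<in> E" for e
  proof (rule Lim_transform_eventually)
    show "((\<lambda>t. ln (W t e) / t - ln (S t) / t) \<longlongrightarrow> Min (c ` E) - c e) at_top"
      using tendsto_diff[OF W_rate[OF that] S_rate] by simp
    show "\<forall>\<^sub>F t in at_top. ln (W t e) / t - ln (S t) / t = ln (w t e) / t"
      using eventually_ge_at_top[of 0]
    proof eventually_elim
      case (elim t)
      then show ?case
        using W_pos[OF elim that] S_pos[OF elim] by (simp add: w_eq ln_div diff_divide_distrib)
    qed
  qed
  have "\<exists>C>0. \<exists>\<delta>>0. \<forall>t\<ge>0. w t e \<le> C * exp (- \<delta> * t)"
    if e: "e \<in> E" "c e \<noteq> Min (c ` E)" for e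
  proof (rule exponential_bound[OF w_pos w_le w_rate[OF e(1)]])
    show "Min (c ` E) - c e < 0" using e finE by (simp add: order_neq_le_trans)
  qed (use e in auto)
  then show ?thesis
    using scale c_lim W_rate w_rate by (auto simp: Let_def intro!: exI[of _ c])
qed

end
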